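(* Let $s,s'$ be integers with $0<s'<s$ and let $G$ be a (connected, possibly infinite) graph that is $(s,s')^*$-dismantlable. Then $G$ is $\delta$-hyperbolic with $$\delta = 16(s+s')\left\lceil \frac{s+s'}{s-s'}\right\rceil + \frac{1}{2}\ \leq\ 32\,\frac{s(s+s')}{s-s'} + \frac{1}{2}.$$
   Context: All graphs are undirected, connected, without loops or multiple edges, but not necessarily finite; $d=d_G$ is the shortest-path distance. For a vertex $v$ and integer $r\ge 0$, $B_r(v,G)=\{x\in V: d_G(v,x)\le r\}$. Given a well-order $\preceq$ on $V$, put $X_v=\{w\in V: w\preceq v\}$. A graph $G$ is $(s,s')^*$-dismantlable if $V$ admits a well-order $\preceq$ such that for each vertex $v$ (other than the least element) there exists a vertex $u\neq v$ with $u\preceq v$ and $B_s(v,G)\cap X_v\subseteq B_{s'}(u,G)$. A graph is $\delta$-hyperbolic ($\delta\ge 0$ real) if for any four vertices $u,v,x,y$, the two largest of the three sums $d(u,v)+d(x,y)$, $d(u,x)+d(v,y)$, $d(u,y)+d(v,x)$ differ by at most $2\delta$. *)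

theory Defs
  imports "Graph_Theory.Shortest_Path" "Graph_Theory.Pair_Digraph" "Graph_Theory.Digraph_Component"
begin

text \<open>
  A possibly infinite simple undirected graph is a \<^locale>\<open>pair_bidirected_digraph\<close>: every
  edge is represented by its two opposite arcs, so the number of arcs of a walk is its usual length.
\<close>

definition gdist :: "'a pair_pre_digraph \<Rightarrow> 'a \<Rightarrow> 'a \<Rightarrow> nat" where
  "gdist G u v = (LEAST n. \<exists>p. pre_digraph.awalk (with_proj G) u p v \<and> length p = n)"

text \<open>
  \<^const>\<open>gdist\<close> is unspecified on pairs of vertices not joined by a walk. Otherwise it is the
  library's shortest-path weight for unit weights, but as a natural number.
\<close>

lemma gdist_eq_shortest_path:
  assumes "pair_wf_digraph G" and "u \<rightarrow>\<^sup>*\<^bsub>with_proj G\<^esub> v"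
  shows "wf_digraph.\<mu> (with_proj G) (\<lambda>_. 1) u v = ereal (real (gdist G u v))"
proof -
  interpret pair_wf_digraph G by fact
  have cost: "awalk_cost (\<lambda>_. 1) p = real (length p)" for p :: "('a \<times> 'a) list"
    by (simp add: awalk_cost_def sum_list_triv)
  have "\<exists>n p. awalk u p v \<and> length p = n"
    using assms(2) by (simp add: reachable_awalk)
  then have "\<exists>p. awalk u p v \<and> length p = gdist G u v"
    unfolding gdist_def by (rule LeastI_ex)
  then obtain p where p: "awalk u p v" "length p = gdist G u v"
    by blast
  show ?thesis
    unfolding \<mu>_def cost
  proof (rule INF_eqI)
    fix q assume "q \<in> {p. awalk u p v}"
    then show "ereal (real (gdist G u v)) \<le> ereal (real (length q))"
      unfolding gdist_def by (auto intro: Least_le)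
  next
    fix y assume "\<And>q. q \<in> {p. awalk u p v} \<Longrightarrow> y \<le> ereal (real (length q))"
    then show "y \<le> ereal (real (gdist G u v))"
      using p by (metis mem_Collect_eq)
  qed
qed

definition gball :: "'a pair_pre_digraph \<Rightarrow> nat \<Rightarrow> 'a \<Rightarrow> 'a set" where
  "gball G r v = {x \<in> pverts G. gdist G v x \<le> r}"

definition star_dismantlable :: "nat \<Rightarrow> nat \<Rightarrow> 'a pair_pre_digraph \<Rightarrow> bool" where
  "star_dismantlable s s' G \<longleftrightarrow>
    (\<exists>R. well_order_on (pverts G) R \<and>
      (\<forall>v \<in> pverts G. \<not> (\<forall>w \<in> pverts G. (v, w) \<in> R) \<longrightarrow>
        (\<exists>u \<in> pverts G. u \<noteq> v \<and> (u, v) \<in> R \<and>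
          gball G s v \<inter> under R v \<subseteq> gball G s' u)))"

text \<open>
  After sorting the three sums in increasing order, the two largest stand at positions 2 and 1.
\<close>

definition hyperbolic :: "real \<Rightarrow> 'a pair_pre_digraph \<Rightarrow> bool" where
  "hyperbolic \<delta> G \<longleftrightarrow> \<delta> \<ge> 0 \<and>
    (\<forall>u \<in> pverts G. \<forall>v \<in> pverts G. \<forall>x \<in> pverts G. \<forall>y \<in> pverts G.
      let S = sort [gdist G u v + gdist G x y,
                    gdist G u x + gdist G v y,
                    gdist G u y + gdist G v x]
      in real (S ! 2) - real (S ! 1) \<le> 2 * \<delta>)"

end

theory Submission
  imports Defs
begin

text \<open>
  Dismantling gives a linear isoperimetric inequality in dual form. For 1-Lipschitz integer
  functions \<open>f\<close> and \<open>g\<close>, consider the trapezoidal sum of \<open>f dg\<close> along a closed walk. Let \<open>v\<close> be the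
  greatest vertex of the walk. The arc of length \<open>2s\<close> centred at \<open>v\<close> can be replaced by a walk of
  length \<open>2s'\<close> through the vertex \<open>u\<close> that dominates \<open>v\<close>. The cut-off closed walk has length
  \<open>2(s + s')\<close>, so it contributes at most \<open>(s + s')\<^sup>2 / 2\<close> by the isoperimetric inequality of the
  maximum norm on the plane. Hence the sum is at most \<open>M/4\<close> times the length of the walk, where
  \<open>M = (s + s') \<lceil>(s + s') / (s - s')\<rceil>\<close>.

  If \<open>m\<close> is a point of a geodesic \<open>[m, x]\<close> nearest to \<open>w\<close>, this forces
  \<open>d(w, m) + d(m, x) \<le> d(w, x) + 16 M\<close>. Otherwise \<open>m\<close> has distance more than \<open>8M\<close> from a geodesic
  \<open>[w, x]\<close>, and the choice of \<open>f\<close> as the distance to \<open>[w, x]\<close> truncated at \<open>2M\<close> and of \<open>g\<close> as the distance to a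
  vertex of \<open>[m, w]\<close> gives too large a sum on a closed walk near \<open>m\<close>. Projecting two of four vertices to
  a geodesic between the other two turns this into the four-point condition.
\<close>

section \<open>Trapezoidal sums and variation along lists\<close>

text \<open>
  Twice the trapezoidal sum of \<open>f dg\<close>, which keeps it an integer, along the walk that starts at \<open>x\<close>
  and goes on through the listed vertices.
\<close>

fun stieltjes2 :: "('a \<Rightarrow> int) \<Rightarrow> ('a \<Rightarrow> int) \<Rightarrow> 'a \<Rightarrow> 'a list \<Rightarrow> int" where
  "stieltjes2 f g x [] = 0"
| "stieltjes2 f g x (y # ys) = (f x + f y) * (g y - g x) + stieltjes2 f g y ys"

fun variation :: "('a \<Rightarrow> int) \<Rightarrow> 'a \<Rightarrow> 'a list \<Rightarrow> int" where
  "variation p x [] = 0"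
| "variation p x (y # ys) = \<bar>p y - p x\<bar> + variation p y ys"

lemma stieltjes2_append:
  "stieltjes2 f g x (ys @ zs) = stieltjes2 f g x ys + stieltjes2 f g (last (x # ys)) zs"
  by (induction ys arbitrary: x) auto

lemma variation_append:
  "variation p x (ys @ zs) = variation p x ys + variation p (last (x # ys)) zs"
  by (induction ys arbitrary: x) auto

lemma variation_nonneg: "0 \<le> variation p x ys"
  by (induction ys arbitrary: x) (auto simp: add_nonneg_nonneg)

lemma abs_diff_le_variation: "\<bar>p (last (x # ys)) - p x\<bar> \<le> variation p x ys"
proof (induction ys arbitrary: x)
  case (Cons y ys)
  from Cons[of y] show ?case by (auto split: if_splits)
qed auto

text \<open>The sum telescopes. This evaluates the pieces of a walk on which a truncated distance is
  constant.\<close>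

lemma stieltjes2_const_left:
  assumes "\<And>y. y \<in> set (x # ys) \<Longrightarrow> f y = h"
  shows "stieltjes2 f g x ys = 2 * h * (g (last (x # ys)) - g x)"
  using assms
proof (induction ys arbitrary: x)
  case (Cons y ys)
  from Cons.IH[of y] Cons.prems show ?case by (auto simp: algebra_simps)
qed auto

text \<open>Summation by parts is exact for trapezoidal sums, so (f + g) d(f - g) differs from -2 f
  dg only by the differential of (f^2 - g^2)/2 + f g. \<open>B\<close> is twice this potential and
  cancels on closed walks.\<close>

lemma stieltjes2_rotate_coordinates:
  fixes f g :: "'a \<Rightarrow> int"
  defines "B \<equiv> \<lambda>x. (f x)\<^sup>2 - (g x)\<^sup>2 + 2 * f x * g x"
  shows "stieltjes2 (\<lambda>x. f x + g x) (\<lambda>x. f x - g x) x ys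
    = - 2 * stieltjes2 f g x ys + B (last (x # ys)) - B x"
proof (induction ys arbitrary: x)
  case (Cons y ys)
  from Cons[of y] show ?case
    by (auto simp: B_def algebra_simps power2_eq_square split: if_splits)
qed (simp add: B_def)

text \<open>The weights \<open>p x + p y\<close> double the values of \<open>p\<close>, so
  \<open>c\<close> acts as twice a centring constant. Subtracting it changes the sum only by
  \<open>c\<close> times the net change of \<open>q\<close>.\<close>

lemma abs_stieltjes2_le_variation:
  assumes "\<And>a b. a \<in> set (x # ys) \<Longrightarrow> b \<in> set (x # ys) \<Longrightarrow> \<bar>p a + p b - c\<bar> \<le> P"
  shows "\<bar>stieltjes2 p q x ys - c * (q (last (x # ys)) - q x)\<bar> \<le> P * variation q x ys"
  using assms
proof (induction ys arbitrary: x)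
  case (Cons y ys)
  have IH: "\<bar>stieltjes2 p q y ys - c * (q (last (y # ys)) - q y)\<bar> \<le> P * variation q y ys"
    by (rule Cons.IH) (simp add: Cons.prems)
  have "\<bar>p x + p y - c\<bar> * \<bar>q y - q x\<bar> \<le> P * \<bar>q y - q x\<bar>"
    by (rule mult_right_mono) (use Cons.prems[of x y] in auto)
  then have 1: "\<bar>(p x + p y - c) * (q y - q x)\<bar> \<le> P * \<bar>q y - q x\<bar>"
    by (simp add: abs_mult)
  have "stieltjes2 p q x (y # ys) - c * (q (last (x # y # ys)) - q x)
    = (p x + p y - c) * (q y - q x) + (stieltjes2 p q y ys - c * (q (last (y # ys)) - q y))"
    by (simp add: algebra_simps)
  with IH 1 have "\<bar>stieltjes2 p q x (y # ys) - c * (q (last (x # y # ys)) - q x)\<bar>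
    \<le> P * \<bar>q y - q x\<bar> + P * variation q y ys"
    by linarith
  then show ?case by (simp add: algebra_simps)
qed auto

section \<open>Walks in an integer-valued metric\<close>

text \<open>An abstract metric stands in for the graph; \<open>dist_step\<close> makes every
  distance the length of a walk.\<close>

locale graph_metric =
  fixes V :: "'a set" and d :: "'a \<Rightarrow> 'a \<Rightarrow> nat"
  assumes dist_self: "x \<in> V \<Longrightarrow> d x x = 0"
    and dist_zero: "x \<in> V \<Longrightarrow> y \<in> V \<Longrightarrow> d x y = 0 \<Longrightarrow> x = y"
    and dist_sym: "x \<in> V \<Longrightarrow> y \<in> V \<Longrightarrow> d x y = d y x"
    and dist_triangle: "x \<in> V \<Longrightarrow> y \<in> V \<Longrightarrow> z \<in> V \<Longrightarrow> d x z \<le> d x y + d y z"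
    and dist_step: "x \<in> V \<Longrightarrow> y \<in> V \<Longrightarrow> d x y = Suc n \<Longrightarrow> \<exists>z\<in>V. d x z \<le> 1 \<and> d z y = n"
begin

text \<open>Walks may pause, so they can be padded to any larger length.\<close>

fun walk :: "'a \<Rightarrow> 'a list \<Rightarrow> 'a \<Rightarrow> bool" where
  "walk x [] z \<longleftrightarrow> x \<in> V \<and> z = x"
| "walk x (y # ys) z \<longleftrightarrow> x \<in> V \<and> d x y \<le> 1 \<and> walk y ys z"

text \<open>Only steps of length at most 1 are tested, as sums along walks see nothing else.\<close>

definition lipschitz :: "('a \<Rightarrow> int) \<Rightarrow> bool" where
  "lipschitz f \<longleftrightarrow> (\<forall>x\<in>V. \<forall>y\<in>V. d x y \<le> 1 \<longrightarrow> \<bar>f x - f y\<bar> \<le> 1)"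

definition geodesic :: "(nat \<Rightarrow> 'a) \<Rightarrow> 'a \<Rightarrow> 'a \<Rightarrow> bool" where
  "geodesic \<gamma> x y \<longleftrightarrow> \<gamma> 0 = x \<and> \<gamma> (d x y) = y \<and> (\<forall>i\<le>d x y. \<gamma> i \<in> V) \<and>
    (\<forall>j\<le>d x y. \<forall>i\<le>j. d (\<gamma> i) (\<gamma> j) = j - i)"

lemma walk_start: "walk x ys z \<Longrightarrow> x \<in> V"
  by (cases ys) auto

lemma walk_last: "walk x ys z \<Longrightarrow> last (x # ys) = z"
  by (induction ys arbitrary: x) (auto split: if_splits)

lemma walk_end: "walk x ys z \<Longrightarrow> z \<in> V"
  by (induction ys arbitrary: x) auto

lemma walk_set: "walk x ys z \<Longrightarrow> set ys \<subseteq> V"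
  by (induction ys arbitrary: x) (auto dest: walk_start)

lemma walk_append: "walk x (ys @ zs) z \<longleftrightarrow> (\<exists>y. walk x ys y \<and> walk y zs z)"
proof (induction ys arbitrary: x)
  case Nil
  then show ?case using walk_start by auto
qed auto

lemma walk_appendI: "walk x ys y \<Longrightarrow> walk y zs z \<Longrightarrow> walk x (ys @ zs) z"
  using walk_append by blast

lemma stieltjes2_walk_append:
  "walk x ys y \<Longrightarrow> stieltjes2 f g x (ys @ zs) = stieltjes2 f g x ys + stieltjes2 f g y zs"
  by (simp only: stieltjes2_append walk_last)

lemma variation_walk_append:
  "walk x ys y \<Longrightarrow> variation p x (ys @ zs) = variation p x ys + variation p y zs"
  by (simp only: variation_append walk_last)

lemma abs_diff_le_variation_walk: "walk x ys y \<Longrightarrow> \<bar>p y - p x\<bar> \<le> variation p x ys"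
  using abs_diff_le_variation[of p x ys] by (simp only: walk_last)

lemma walk_dist_le: "walk x ys z \<Longrightarrow> d x z \<le> length ys"
proof (induction ys arbitrary: x)
  case (Cons y ys)
  then have "d x z \<le> d x y + d y z"
    using walk_start[of y ys z] walk_end[of y ys z] by (intro dist_triangle) auto
  with Cons show ?case by fastforce
qed (auto simp: dist_self)

text \<open>The trapezoidal weight is symmetric in the two ends of a step, so reversal changes only
  the sign of the increment of \<open>g\<close>.\<close>

lemma walk_reverse:
  assumes "walk x ys z"
  obtains zs where "walk z zs x" "length zs = length ys" "set (z # zs) = set (x # ys)"
    "\<And>f g. stieltjes2 f g z zs = - stieltjes2 f g x ys"
proof -
  have "\<exists>zs. walk z zs x \<and> length zs = length ys \<and> set (z # zs) = set (x # ys) \<and>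
    (\<forall>f g. stieltjes2 f g z zs = - stieltjes2 f g x ys)"
    using assms
  proof (induction ys arbitrary: x)
    case Nil
    then show ?case by (intro exI[of _ "[]"]) auto
  next
    case (Cons y ys)
    from Cons.IH[of y] Cons.prems
    obtain zs where zs: "walk z zs y" "length zs = length ys" "set (z # zs) = set (y # ys)"
      "\<forall>f g. stieltjes2 f g z zs = - stieltjes2 f g y ys"
      by (metis walk.simps(2))
    have xy: "x \<in> V" "y \<in> V" "d x y \<le> 1"
      using Cons.prems walk_start by auto
    then have "walk y [x] x"
      using dist_sym[of x y] by auto
    then have w: "walk z (zs @ [x]) x"
      using zs(1) by (rule walk_appendI[rotated])
    have st: "stieltjes2 f g z (zs @ [x]) = - stieltjes2 f g x (y # ys)" for f g
      unfolding stieltjes2_walk_append[OF zs(1)] using zs(4) by (simp add: algebra_simps)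
    have "set (z # zs @ [x]) = set (x # y # ys)"
      using zs(3) by auto
    then show ?case
      using w st zs(2) by (intro exI[of _ "zs @ [x]"]) auto
  qed
  then show ?thesis using that by blast
qed

lemma walk_split:
  assumes "walk x ys z" "a \<in> set (x # ys)"
  obtains A B where "ys = A @ B" "walk x A a" "walk a B z"
proof -
  have "\<exists>A B. ys = A @ B \<and> walk x A a \<and> walk a B z"
    using assms
  proof (induction ys arbitrary: x)
    case Nil
    then show ?case by auto
  next
    case (Cons y ys)
    show ?case
    proof (cases "a = x")
      case True
      then show ?thesis using Cons.prems by (intro exI[of _ "[]"] exI[of _ "y # ys"]) auto
    next
      case False
      with Cons obtain A B where "ys = A @ B" "walk y A a" "walk a B z"
        by (metis set_ConsD walk.simps(2))
      then show ?thesis using Cons.prems by (intro exI[of _ "y # A"] exI[of _ B]) auto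
    qed
  qed
  then show ?thesis using that by blast
qed

text \<open>Cutting at \<open>a\<close> and exchanging the two pieces preserves every sum, so any
  vertex of the walk can serve as its base point.\<close>

lemma closed_walk_rotate:
  assumes "walk x ys x" "a \<in> set (x # ys)"
  obtains zs where "walk a zs a" "length zs = length ys" "set (a # zs) = set (x # ys)"
    "\<And>f g. stieltjes2 f g a zs = stieltjes2 f g x ys"
    "\<And>p. variation p a zs = variation p x ys"
proof -
  obtain A B where AB: "ys = A @ B" "walk x A a" "walk a B x"
    using walk_split[OF assms] .
  have "a \<in> set (x # A)" "x \<in> set (a # B)"
    using walk_last[OF AB(2)] walk_last[OF AB(3)] last_in_set[of "x # A"] last_in_set[of "a # B"]
    by auto
  then have "set (a # B @ A) = set (x # ys)"
    unfolding AB(1) by auto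
  moreover have "walk a (B @ A) a"
    using AB by (auto intro: walk_appendI)
  ultimately show ?thesis
    by (intro that[of "B @ A"])
      (auto simp: AB(1) stieltjes2_walk_append[OF AB(2)] stieltjes2_walk_append[OF AB(3)]
        variation_walk_append[OF AB(2)] variation_walk_append[OF AB(3)])
qed

section \<open>The quadratic isoperimetric inequality\<close>

text \<open>The walk goes from \<open>a\<close> to \<open>b\<close> and back, and each of the two
  parts has variation at least \<open>\<bar>p a - p b\<bar>\<close>.\<close>

lemma closed_walk_range_le_variation:
  assumes "walk x ys x" "a \<in> set (x # ys)" "b \<in> set (x # ys)"
  shows "2 * \<bar>p a - p b\<bar> \<le> variation p x ys"
proof -
  obtain zs where zs: "walk a zs a" "set (a # zs) = set (x # ys)"
    "variation p a zs = variation p x ys"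
    using closed_walk_rotate[OF assms(1,2)] by metis
  obtain A B where AB: "zs = A @ B" "walk a A b" "walk b B a"
    using walk_split[OF zs(1)] assms(3) zs(2) by metis
  show ?thesis
    using abs_diff_le_variation_walk[OF AB(2), of p] abs_diff_le_variation_walk[OF AB(3), of p]
      zs(3) variation_walk_append[OF AB(2), of p B]
    unfolding AB(1) by arith
qed

text \<open>Per step, |df + dg| + |df - dg| = 2 max(|df|, |dg|), and both increments are at most 1
  in absolute value.\<close>

lemma variation_sum_diff_le:
  assumes "walk x ys z" "lipschitz f" "lipschitz g"
  shows "variation (\<lambda>x. f x + g x) x ys + variation (\<lambda>x. f x - g x) x ys \<le> 2 * int (length ys)"
  using assms(1)
proof (induction ys arbitrary: x)
  case (Cons y ys)
  then have "x \<in> V" "y \<in> V" "d x y \<le> 1"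
    using walk_start by auto
  then have "\<bar>f x - f y\<bar> \<le> 1" "\<bar>g x - g y\<bar> \<le> 1"
    using assms unfolding lipschitz_def by auto
  moreover have "variation (\<lambda>x. f x + g x) y ys + variation (\<lambda>x. f x - g x) y ys
      \<le> 2 * int (length ys)"
    using Cons by auto
  ultimately show ?case by (auto simp: abs_if split: if_splits)
qed auto

lemma isoperimetric:
  assumes w: "walk x ys x" and f: "lipschitz f" and g: "lipschitz g"
  shows "4 * \<bar>stieltjes2 f g x ys\<bar> \<le> (int (length ys))\<^sup>2"
proof -
  \<comment> \<open>In the coordinates \<open>p, q\<close> the maximum norm becomes half the sum norm, so that \<open>\<bar>dp\<bar> + \<bar>dq\<bar> \<le> 2\<close> per step.\<close>
  define p where "p = (\<lambda>x. f x + g x)"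
  define q where "q = (\<lambda>x. f x - g x)"
  define S where "S = p ` set (x # ys)"
  define P where "P = Max S - Min S"
  have fin: "finite S" "S \<noteq> {}" by (auto simp: S_def)
  have "Max S \<in> S" "Min S \<in> S"
    using fin Max_in Min_in by auto
  then obtain a b where ab: "a \<in> set (x # ys)" "Max S = p a" "b \<in> set (x # ys)" "Min S = p b"
    unfolding S_def by blast
  have 2: "2 * P \<le> variation p x ys"
    using closed_walk_range_le_variation[OF w ab(1,3), of p] ab(2,4) unfolding P_def by arith
  have bd: "\<bar>p u + p v - (Max S + Min S)\<bar> \<le> P" if "u \<in> set (x # ys)" "v \<in> set (x # ys)" for u v
  proof -
    have "p u \<in> S" "p v \<in> S" using that unfolding S_def by auto
    then have "p u \<le> Max S" "Min S \<le> p u" "p v \<le> Max S" "Min S \<le> p v"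
      using fin by auto
    then show ?thesis unfolding P_def by arith
  qed
  \<comment> \<open>\<open>Max S + Min S\<close> is twice the midrange of \<open>p\<close>, the best
    centre; the correction term vanishes because the walk is closed.\<close>
  have "\<bar>stieltjes2 p q x ys - (Max S + Min S) * (q (last (x # ys)) - q x)\<bar> \<le> P * variation q x ys"
    by (rule abs_stieltjes2_le_variation) (rule bd)
  then have 3: "\<bar>stieltjes2 p q x ys\<bar> \<le> P * variation q x ys"
    unfolding walk_last[OF w] by simp
  have 4: "stieltjes2 p q x ys = - 2 * stieltjes2 f g x ys"
    using stieltjes2_rotate_coordinates[of f g x ys] unfolding walk_last[OF w] p_def q_def by simp
  define U where "U = variation p x ys"
  define W where "W = variation q x ys"
  have W0: "0 \<le> W" "0 \<le> U"
    unfolding W_def U_def by (rule variation_nonneg)+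
  have UW: "U + W \<le> 2 * int (length ys)"
    using variation_sum_diff_le[OF w f g] unfolding U_def W_def p_def q_def by simp
  have "4 * \<bar>stieltjes2 f g x ys\<bar> \<le> 2 * P * W"
    using 3 4 unfolding W_def by arith
  also have "\<dots> \<le> U * W"
    using 2 W0 unfolding U_def by (intro mult_right_mono) auto
  finally have "4 * \<bar>stieltjes2 f g x ys\<bar> \<le> U * W" .
  \<comment> \<open>For a fixed sum of the two variations, their product is largest when they
    agree.\<close>
  moreover have "4 * (U * W) \<le> (U + W)\<^sup>2"
    using zero_le_power2[of "U - W"] by (simp add: power2_eq_square algebra_simps)
  moreover have "(U + W)\<^sup>2 \<le> (2 * int (length ys))\<^sup>2"
    using UW W0 by (intro power_mono) auto
  ultimately show ?thesis
    by (simp add: power2_eq_square)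
qed

text \<open>The value of \<open>f\<close> is at most the number of remaining steps, so the weights,
  counted from the end, are at most 1, 3, 5, and so on. These odd numbers add up to a
  square.\<close>

lemma abs_stieltjes2_le_square:
  assumes "walk x ys z" "lipschitz f" "lipschitz g" "f z = 0"
  shows "\<bar>f x\<bar> \<le> int (length ys) \<and> \<bar>stieltjes2 f g x ys\<bar> \<le> (int (length ys))\<^sup>2"
  using assms(1)
proof (induction ys arbitrary: x)
  case Nil
  then show ?case using assms(4) by auto
next
  case (Cons y ys)
  then have "x \<in> V" "y \<in> V" "d x y \<le> 1"
    using walk_start by auto
  then have fg: "\<bar>f x - f y\<bar> \<le> 1" "\<bar>g y - g x\<bar> \<le> 1"
    using assms unfolding lipschitz_def by (auto simp: abs_minus_commute)
  have IH: "\<bar>f y\<bar> \<le> int (length ys)" "\<bar>stieltjes2 f g y ys\<bar> \<le> (int (length ys))\<^sup>2"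
    using Cons by auto
  have "\<bar>(f x + f y) * (g y - g x)\<bar> \<le> \<bar>f x + f y\<bar> * 1"
    unfolding abs_mult using fg by (intro mult_left_mono) auto
  also have "\<dots> \<le> 2 * int (length ys) + 1"
    using fg IH by arith
  finally have "\<bar>stieltjes2 f g x (y # ys)\<bar> \<le> 2 * int (length ys) + 1 + (int (length ys))\<^sup>2"
    using IH(2) by simp
  then show ?case
    using IH(1) fg by (auto simp: power2_eq_square algebra_simps)
qed

section \<open>Geodesics\<close>

lemma geodesicD:
  assumes "geodesic \<gamma> x y"
  shows "\<gamma> 0 = x" "\<gamma> (d x y) = y" "x \<in> V" "y \<in> V"
    and "i \<le> d x y \<Longrightarrow> \<gamma> i \<in> V"
    and "i \<le> j \<Longrightarrow> j \<le> d x y \<Longrightarrow> d (\<gamma> i) (\<gamma> j) = j - i"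
    and "i \<le> d x y \<Longrightarrow> d x (\<gamma> i) = i"
    and "i \<le> d x y \<Longrightarrow> d (\<gamma> i) y = d x y - i"
proof -
  show *: "\<gamma> 0 = x" "\<gamma> (d x y) = y" and V: "\<And>i. i \<le> d x y \<Longrightarrow> \<gamma> i \<in> V"
    and D: "\<And>i j. i \<le> j \<Longrightarrow> j \<le> d x y \<Longrightarrow> d (\<gamma> i) (\<gamma> j) = j - i"
    using assms unfolding geodesic_def by blast+
  show "x \<in> V" "y \<in> V"
    using V[of 0] V[of "d x y"] * by simp_all
  show "i \<le> d x y \<Longrightarrow> d x (\<gamma> i) = i" "i \<le> d x y \<Longrightarrow> d (\<gamma> i) y = d x y - i"
    using D[of 0 i] D[of i "d x y"] * by simp_all
qed

lemma geodesic_exists: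
  assumes "x \<in> V" "y \<in> V"
  obtains \<gamma> where "geodesic \<gamma> x y"
proof -
  have "\<exists>\<gamma>. geodesic \<gamma> x y"
    using assms
  proof (induction "d x y" arbitrary: x)
    case 0
    then have "x = y" using dist_zero by auto
    then show ?case using 0 dist_self by (intro exI[of _ "\<lambda>_. x"]) (auto simp: geodesic_def)
  next
    case (Suc n)
    then obtain z where z: "z \<in> V" "d x z \<le> 1" "d z y = n"
      using dist_step by metis
    then obtain \<gamma> where \<gamma>: "geodesic \<gamma> z y" using Suc by metis
    have \<gamma>0: "\<gamma> 0 = z" "\<gamma> n = y"
      and \<gamma>V: "\<And>i. i \<le> n \<Longrightarrow> \<gamma> i \<in> V"
      and \<gamma>d: "\<And>i j. j \<le> n \<Longrightarrow> i \<le> j \<Longrightarrow> d (\<gamma> i) (\<gamma> j) = j - i"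
      using \<gamma> z(3) by (simp_all add: geodesic_def)
    have zi: "\<gamma> i \<in> V" "d z (\<gamma> i) = i" "d (\<gamma> i) y = n - i" if "i \<le> n" for i
      using \<gamma>V[OF that] \<gamma>d[OF that, of 0] \<gamma>d[of n i] that \<gamma>0 by simp_all
    have xi: "d x (\<gamma> i) = Suc i" if "i \<le> n" for i
    proof -
      have "d x (\<gamma> i) \<le> d x z + d z (\<gamma> i)" "d x y \<le> d x (\<gamma> i) + d (\<gamma> i) y"
        using Suc.prems z zi(1)[OF that] by (simp_all only: dist_triangle)
      then show ?thesis using z zi[OF that] Suc.hyps that by linarith
    qed
    have "geodesic (case_nat x \<gamma>) x y"
      unfolding geodesic_def Suc.hyps(2)[symmetric]
    proof (intro conjI allI impI)
      show "(case Suc n of 0 \<Rightarrow> x | Suc i \<Rightarrow> \<gamma> i) = y"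
        by (simp add: \<gamma>0)
      show "(case i of 0 \<Rightarrow> x | Suc i \<Rightarrow> \<gamma> i) \<in> V" if "i \<le> Suc n" for i
        using that \<gamma>V Suc.prems(1) by (cases i) simp_all
      show "d (case i of 0 \<Rightarrow> x | Suc i \<Rightarrow> \<gamma> i) (case j of 0 \<Rightarrow> x | Suc i \<Rightarrow> \<gamma> i) = j - i"
        if "j \<le> Suc n" "i \<le> j" for i j
      proof (cases j)
        case 0
        with that show ?thesis using Suc.prems by (simp add: dist_self)
      next
        case (Suc k)
        with that show ?thesis using xi[of k] \<gamma>d[of k] Suc.prems(1) by (cases i) (simp_all add: dist_self)
      qed
    qed simp
    then show ?case by blast
  qed
  then show ?thesis using that by blast
qed

lemma geodesic_subwalk:
  assumes "geodesic \<gamma> x y" "i \<le> j" "j \<le> d x y"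
  obtains ys where "walk (\<gamma> i) ys (\<gamma> j)" "length ys = j - i" "set (\<gamma> i # ys) = \<gamma> ` {i..j}"
proof -
  have "\<exists>ys. walk (\<gamma> i) ys (\<gamma> j) \<and> length ys = j - i \<and> set (\<gamma> i # ys) = \<gamma> ` {i..j}"
    using assms(2,3)
  proof (induction j rule: dec_induct)
    case base
    then show ?case using assms(1) by (intro exI[of _ "[]"]) (auto simp: geodesic_def)
  next
    case (step j)
    then obtain ys where ys: "walk (\<gamma> i) ys (\<gamma> j)" "length ys = j - i" "set (\<gamma> i # ys) = \<gamma> ` {i..j}"
      by auto
    have "walk (\<gamma> j) [\<gamma> (Suc j)] (\<gamma> (Suc j))"
      using assms(1) step.prems unfolding geodesic_def by auto
    then have "walk (\<gamma> i) (ys @ [\<gamma> (Suc j)]) (\<gamma> (Suc j))"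
      using ys(1) walk_appendI by blast
    moreover have "set (\<gamma> i # ys @ [\<gamma> (Suc j)]) = \<gamma> ` {i..Suc j}"
      using ys(3) step.hyps by (auto simp: atLeastAtMostSuc_conv)
    ultimately show ?case
      using ys(2) step.hyps by (intro exI[of _ "ys @ [\<gamma> (Suc j)]"]) auto
  qed
  then show ?thesis using that by blast
qed

lemma geodesic_connect:
  assumes "geodesic \<gamma> x y" "i \<le> d x y" "j \<le> d x y"
  obtains ys where "walk (\<gamma> i) ys (\<gamma> j)" "length ys = d (\<gamma> i) (\<gamma> j)"
    "set (\<gamma> i # ys) \<subseteq> \<gamma> ` {..d x y}"
proof (cases "i \<le> j")
  case True
  then obtain ys where ys: "walk (\<gamma> i) ys (\<gamma> j)" "length ys = j - i" "set (\<gamma> i # ys) = \<gamma> ` {i..j}"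
    using geodesic_subwalk assms by metis
  moreover have "d (\<gamma> i) (\<gamma> j) = j - i"
    using assms True by (simp add: geodesic_def)
  moreover have "\<gamma> ` {i..j} \<subseteq> \<gamma> ` {..d x y}"
    using assms by auto
  ultimately show ?thesis by (intro that[of ys]) simp_all
next
  case False
  then obtain ys where ys: "walk (\<gamma> j) ys (\<gamma> i)" "length ys = i - j" "set (\<gamma> j # ys) = \<gamma> ` {j..i}"
    using geodesic_subwalk[OF assms(1), of j i] assms by force
  obtain zs where zs: "walk (\<gamma> i) zs (\<gamma> j)" "length zs = length ys"
    "set (\<gamma> i # zs) = set (\<gamma> j # ys)"
    using walk_reverse[OF ys(1)] by metis
  have "d (\<gamma> i) (\<gamma> j) = d (\<gamma> j) (\<gamma> i)"
    using assms dist_sym by (simp add: geodesic_def)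
  then have "d (\<gamma> i) (\<gamma> j) = i - j"
    using assms False by (simp add: geodesic_def)
  moreover have "\<gamma> ` {j..i} \<subseteq> \<gamma> ` {..d x y}"
    using assms by auto
  ultimately show ?thesis using ys zs by (intro that[of zs]) simp_all
qed

lemma walk_exists:
  assumes "x \<in> V" "y \<in> V" "d x y \<le> n"
  obtains ys where "walk x ys y" "length ys = n"
proof -
  obtain \<gamma> where \<gamma>: "geodesic \<gamma> x y"
    using geodesic_exists assms by blast
  obtain ys where "walk (\<gamma> 0) ys (\<gamma> (d x y))" "length ys = d x y - 0"
    using geodesic_subwalk[OF \<gamma> le0 order_refl] .
  then have ys: "walk x ys y" "length ys = d x y"
    by (simp_all add: geodesicD[OF \<gamma>])
  have "walk y (replicate k y) y" for k
    using assms(2) dist_self by (induction k) auto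
  then have "walk x (ys @ replicate (n - d x y) y) y"
    using ys(1) walk_appendI by blast
  then show ?thesis
    using ys(2) assms(3) by (intro that[of "ys @ replicate (n - d x y) y"]) auto
qed

lemma geodesic_sym:
  assumes "geodesic \<gamma> x y"
  shows "geodesic (\<lambda>i. \<gamma> (d x y - i)) y x"
proof -
  note xy = geodesicD(3,4)[OF assms]
  have V: "\<gamma> i \<in> V" if "i \<le> d x y" for i
    using assms that by (simp add: geodesic_def)
  have "d (\<gamma> (d x y - i)) (\<gamma> (d x y - j)) = j - i" if "j \<le> d x y" "i \<le> j" for i j
  proof -
    have "d (\<gamma> (d x y - j)) (\<gamma> (d x y - i)) = (d x y - i) - (d x y - j)"
      using assms that by (auto simp: geodesic_def)
    then show ?thesis
      using that dist_sym[of "\<gamma> (d x y - j)" "\<gamma> (d x y - i)"] V by auto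
  qed
  then show ?thesis
    using assms V dist_sym[OF xy] unfolding geodesic_def by auto
qed

lemma geodesic_sub:
  assumes "geodesic \<gamma> x y" "k \<le> d x y"
  shows "geodesic (\<lambda>i. \<gamma> (k + i)) (\<gamma> k) y" "d (\<gamma> k) y = d x y - k"
proof -
  show *: "d (\<gamma> k) y = d x y - k"
    using assms by (rule geodesicD)
  show "geodesic (\<lambda>i. \<gamma> (k + i)) (\<gamma> k) y"
    using assms unfolding geodesic_def * by auto
qed

text \<open>Discrete intermediate value theorem: \<open>\<phi>\<close> drops by at most 1 per step,
  so its value at the first index where it is at most \<open>h\<close> is exactly
  \<open>h\<close>.\<close>

lemma geodesic_first_hit:
  fixes \<phi> :: "'a \<Rightarrow> nat"
  assumes \<gamma>: "geodesic \<gamma> x y"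
    and lip: "\<And>u v. u \<in> V \<Longrightarrow> v \<in> V \<Longrightarrow> \<phi> u \<le> \<phi> v + d u v"
    and "h < \<phi> x" "\<phi> y \<le> h"
  obtains k where "k \<le> d x y" "\<phi> (\<gamma> k) = h" "\<forall>i\<le>k. h \<le> \<phi> (\<gamma> i)"
proof -
  define k where "k = (LEAST k. \<phi> (\<gamma> k) \<le> h)"
  have y: "\<phi> (\<gamma> (d x y)) \<le> h" using \<gamma> assms by (simp add: geodesic_def)
  have k: "\<phi> (\<gamma> k) \<le> h"
    unfolding k_def using y by (rule LeastI)
  have kn: "k \<le> d x y"
    unfolding k_def using y by (rule Least_le)
  have less: "h < \<phi> (\<gamma> i)" if "i < k" for i
    using not_less_Least[of i "\<lambda>k. \<phi> (\<gamma> k) \<le> h"] that unfolding k_def by auto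
  have "k \<noteq> 0" using k \<gamma> assms by (metis geodesic_def not_le)
  then obtain l where l: "k = Suc l" by (cases k) auto
  have "\<phi> (\<gamma> l) \<le> \<phi> (\<gamma> k) + d (\<gamma> l) (\<gamma> k)"
    using \<gamma> kn l by (intro lip) (auto simp: geodesic_def)
  also have "d (\<gamma> l) (\<gamma> k) = 1"
    using \<gamma> kn l by (auto simp: geodesic_def)
  finally have "\<phi> (\<gamma> k) = h" using less[of l] l k by auto
  then show ?thesis
    using kn less by (intro that[of k]) (auto simp: le_less)
qed

end

section \<open>The linear isoperimetric inequality\<close>

text \<open>
  The vertex \<open>u\<close> in \<open>shortcut\<close> may be \<open>v\<close> itself: if the greatest vertex of \<open>S\<close> is the least element of
  the well-order, then \<open>S = {v}\<close>.
\<close>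

locale shortcut_metric = graph_metric +
  fixes s s' M :: nat
  assumes s'_less_s: "s' < s"
    and shortcut: "finite S \<Longrightarrow> S \<noteq> {} \<Longrightarrow> S \<subseteq> V \<Longrightarrow>
      \<exists>v\<in>S. \<exists>u\<in>V. \<forall>w\<in>S. d v w \<le> s \<longrightarrow> d u w \<le> s'"
    and M_bound: "(s + s')\<^sup>2 \<le> M * (s - s')"
begin

text \<open>Otherwise M (s - s') < s^2 \<le> (s + s')^2, against \<open>M_bound\<close>. This
  settles the short walks of the induction below and makes \<open>M\<close> positive.\<close>

lemma s_le_M: "s \<le> M"
proof (rule ccontr)
  assume "\<not> s \<le> M"
  then have "M * (s - s') < s * s"
    using s'_less_s by (metis diff_le_self le_less_trans mult_le_mono2 mult_less_mono1 not_le zero_less_diff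
      less_le_trans mult_less_cancel2)
  also have "s * s \<le> (s + s')\<^sup>2"
    unfolding power2_eq_square by (intro mult_le_mono) simp_all
  finally show False
    using M_bound by simp
qed

lemma linear_isoperimetric:
  assumes "walk x ys x" and f: "lipschitz f" and g: "lipschitz g"
  shows "2 * \<bar>stieltjes2 f g x ys\<bar> \<le> int M * int (length ys)"
  using assms(1)
proof (induction "length ys" arbitrary: x ys rule: less_induct)
  case less
  let ?n = "length ys"
  show ?case
  proof (cases "?n < 2 * s")
    \<comment> \<open>Below length 2s, hence below 2M, the quadratic bound is already
      linear.\<close>
    case True
    have "4 * \<bar>stieltjes2 f g x ys\<bar> \<le> int ?n * int ?n"
      using isoperimetric[OF less.prems f g] by (simp add: power2_eq_square)
    also have "\<dots> \<le> int (2 * M) * int ?n"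
      using True s_le_M by (intro mult_right_mono) auto
    finally show ?thesis by simp
  next
    case False
    have S: "set (x # ys) \<subseteq> V"
      using walk_set[OF less.prems] walk_start[OF less.prems] by auto
    obtain v u where v: "v \<in> set (x # ys)" and u: "u \<in> V"
      and vu: "\<And>w. w \<in> set (x # ys) \<Longrightarrow> d v w \<le> s \<Longrightarrow> d u w \<le> s'"
      using shortcut[of "set (x # ys)"] S by auto
    obtain zs where zs: "walk v zs v" "length zs = ?n" "set (v # zs) = set (x # ys)"
      "stieltjes2 f g v zs = stieltjes2 f g x ys"
      using closed_walk_rotate[OF less.prems v] by metis
    \<comment> \<open>\<open>Z1\<close> and \<open>Z3\<close> are the \<open>s\<close> steps after
      and before \<open>v\<close>, so their outer ends \<open>q\<close> and \<open>p\<close> are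
      within \<open>s\<close> of \<open>v\<close> and hence within \<open>s'\<close> of
      \<open>u\<close>.\<close>
    define Z1 where "Z1 = take s zs"
    define Z2 where "Z2 = take (?n - 2 * s) (drop s zs)"
    define Z3 where "Z3 = drop (?n - 2 * s) (drop s zs)"
    have Z: "zs = Z1 @ Z2 @ Z3"
      unfolding Z1_def Z2_def Z3_def by (simp only: append_take_drop_id)
    have len: "length Z1 = s" "length Z2 = ?n - 2 * s" "length Z3 = s"
      using False unfolding Z1_def Z2_def Z3_def by (auto simp: zs(2))
    obtain q p where qp: "walk v Z1 q" "walk q Z2 p" "walk p Z3 v"
      using zs(1) unfolding Z walk_append by blast
    have "q \<in> set (v # Z1)" "p \<in> set (q # Z2)"
      using walk_last[OF qp(1)] walk_last[OF qp(2)] last_in_set[of "v # Z1"] last_in_set[of "q # Z2"]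
      by auto
    then have qpS: "q \<in> set (x # ys)" "p \<in> set (x # ys)"
      unfolding zs(3)[symmetric] Z by auto
    then have V: "v \<in> V" "q \<in> V" "p \<in> V"
      using S v by auto
    have "d v q \<le> s" "d v p \<le> s"
      using walk_dist_le[OF qp(1)] walk_dist_le[OF qp(3)] len dist_sym[OF V(1,3)] by auto
    then have uq: "d u q \<le> s'" and up: "d u p \<le> s'"
      using vu qpS by blast+
    have pu: "d p u \<le> s'"
      using up dist_sym[OF u V(3)] by simp
    obtain P where P: "walk p P u" "length P = s'"
      using walk_exists[OF V(3) u pu] .
    obtain Q where Q: "walk u Q q" "length Q = s'"
      using walk_exists[OF u V(2) uq] .
    have pq: "walk p (P @ Q) q" "length (P @ Q) = 2 * s'"
      using walk_appendI[OF P(1) Q(1)] P(2) Q(2) by simp_all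
    \<comment> \<open>\<open>R\<close> reverses the detour \<open>P @ Q\<close> through
      \<open>u\<close>. The two sums cancel, so the walk splits into a shorter closed walk and a
      face of length 2(s + s').\<close>
    obtain R where R: "walk q R p" "length R = 2 * s'"
      "stieltjes2 f g q R = - stieltjes2 f g p (P @ Q)"
      using walk_reverse[OF pq(1)] pq(2) by metis
    have "length (Z2 @ P @ Q) = ?n - 2 * s + 2 * s'"
      using len pq(2) by simp
    moreover have "walk q (Z2 @ P @ Q) q"
      using qp(2) pq(1) by (rule walk_appendI)
    ultimately have IH: "2 * \<bar>stieltjes2 f g q (Z2 @ P @ Q)\<bar> \<le> int M * int (?n - 2 * s + 2 * s')"
      using less.hyps[of "Z2 @ P @ Q" q] s'_less_s False by auto
    have "walk v (Z1 @ R @ Z3) v"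
      by (intro walk_appendI[OF qp(1)] walk_appendI[OF R(1)] qp(3))
    from isoperimetric[OF this f g]
    have face: "\<bar>stieltjes2 f g v (Z1 @ R @ Z3)\<bar> \<le> (int (s + s'))\<^sup>2"
      by (simp add: len R(2) power2_eq_square algebra_simps)
    have "stieltjes2 f g x ys = stieltjes2 f g q (Z2 @ P @ Q) + stieltjes2 f g v (Z1 @ R @ Z3)"
      unfolding zs(4)[symmetric] Z stieltjes2_walk_append[OF qp(1)] stieltjes2_walk_append[OF qp(2)]
        stieltjes2_walk_append[OF R(1)] R(3) by simp
    then have "2 * \<bar>stieltjes2 f g x ys\<bar> \<le> int M * int (?n - 2 * s + 2 * s') + 2 * (int (s + s'))\<^sup>2"
      using IH face by arith
    \<comment> \<open>The quadratic cost of the face is charged to the 2(s - s') steps saved, at the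
      rate \<open>M\<close> per step.\<close>
    also have "\<dots> \<le> int M * int (?n - 2 * s + 2 * s') + 2 * (int M * int (s - s'))"
      using M_bound by (metis add_left_mono mult_left_mono of_nat_le_iff of_nat_mult of_nat_power
        zero_le_numeral)
    also have "\<dots> = int M * int (?n - 2 * s + 2 * s' + 2 * (s - s'))"
      unfolding of_nat_add of_nat_mult of_nat_numeral by (simp only: distrib_left mult_ac)
    also have "?n - 2 * s + 2 * s' + 2 * (s - s') = ?n"
      using False s'_less_s by simp
    finally show ?thesis .
  qed
qed

section \<open>Triangles with a nearest-point corner\<close>

lemma right_triangle:
  assumes w: "w \<in> V" and \<mu>: "geodesic \<mu> m x"
    and nearest: "\<And>i. i \<le> d m x \<Longrightarrow> d w m \<le> d w (\<mu> i)"
  shows "d w m + d m x \<le> d w x + 16 * M"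
proof (rule ccontr)
  assume contr: "\<not> d w m + d m x \<le> d w x + 16 * M"
  note mx = geodesicD(3,4)[OF \<mu>]
  obtain \<alpha> where \<alpha>: "geodesic \<alpha> w x"
    using geodesic_exists w mx by blast
  obtain \<omega> where \<omega>: "geodesic \<omega> m w"
    using geodesic_exists w mx by blast
  note \<alpha>V = geodesicD(5)[OF \<alpha>]
  define \<phi> where "\<phi> y = Min ((\<lambda>i. d y (\<alpha> i)) ` {..d w x})" for y
  have \<phi>_le: "\<phi> y \<le> d y (\<alpha> i)" if "i \<le> d w x" for y i
    unfolding \<phi>_def using that by (intro Min_le) auto
  have \<phi>_ex: "\<exists>i\<le>d w x. \<phi> y = d y (\<alpha> i)" for y
  proof -
    have "\<phi> y \<in> (\<lambda>i. d y (\<alpha> i)) ` {..d w x}"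
      unfolding \<phi>_def by (intro Min_in) auto
    then show ?thesis by auto
  qed
  have \<phi>_lip: "\<phi> u \<le> \<phi> v + d u v" if "u \<in> V" "v \<in> V" for u v
  proof -
    obtain i where i: "i \<le> d w x" "\<phi> v = d v (\<alpha> i)"
      using \<phi>_ex by blast
    then show ?thesis
      using \<phi>_le[OF i(1), of u] dist_triangle[OF that \<alpha>V[OF i(1)]] by linarith
  qed
  have \<phi>0: "\<phi> (\<alpha> i) = 0" if "i \<le> d w x" for i
    using \<phi>_le[OF that, of "\<alpha> i"] dist_self \<alpha>V[OF that] by simp
  have \<phi>_ends: "\<phi> w = 0" "\<phi> x = 0"
    using \<phi>0[of 0] \<phi>0[of "d w x"] by (simp_all add: geodesicD[OF \<alpha>])
  have \<phi>m: "8 * M < \<phi> m"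
  proof -
    obtain i where i: "i \<le> d w x" "\<phi> m = d m (\<alpha> i)"
      using \<phi>_ex by blast
    \<comment> \<open>The point of \<open>\<alpha>\<close> nearest to \<open>m\<close> splits
      \<open>d w x\<close> exactly. Adding both inequalities bounds the excess by twice
      \<open>\<phi> m\<close>.\<close>
    have "d w m \<le> d w (\<alpha> i) + d (\<alpha> i) m" "d m x \<le> d m (\<alpha> i) + d (\<alpha> i) x"
      using w mx \<alpha>V[OF i(1)] by (simp_all only: dist_triangle)
    then show ?thesis
      using i contr geodesicD(7,8)[OF \<alpha> i(1)] dist_sym[OF mx(1) \<alpha>V[OF i(1)]] by linarith
  qed
  \<comment> \<open>For h = cM the estimates below refute \<open>\<phi> m\<close> > 2c^2/(c - 1) M;
    the choice c = 2 minimises this threshold, at 8M.\<close>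
  define h where "h = 2 * M"
  have h: "h < \<phi> m"
    using \<phi>m unfolding h_def by linarith
  have ends_le: "\<phi> w \<le> h" "\<phi> x \<le> h"
    using \<phi>_ends by simp_all
  \<comment> \<open>Up to the first hit of level \<open>h\<close>, both sides leaving
    \<open>m\<close> keep \<open>\<phi>\<close> at least \<open>h\<close>, so \<open>f\<close> will
    be constant there.\<close>
  obtain k where k: "k \<le> d m w" "\<phi> (\<omega> k) = h" "\<forall>i\<le>k. h \<le> \<phi> (\<omega> i)"
    using geodesic_first_hit[OF \<omega> \<phi>_lip h ends_le(1)] .
  obtain l where l: "l \<le> d m x" "\<phi> (\<mu> l) = h" "\<forall>i\<le>l. h \<le> \<phi> (\<mu> i)"
    using geodesic_first_hit[OF \<mu> \<phi>_lip h ends_le(2)] .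
  define a where "a = \<omega> k"
  define b where "b = \<mu> l"
  define G where "G = d a b"
  have ab: "a \<in> V" "b \<in> V"
    unfolding a_def b_def using geodesicD(5)[OF \<omega> k(1)] geodesicD(5)[OF \<mu> l(1)] .
  have dma: "d m a = k" "d a w = d m w - k"
    unfolding a_def using geodesicD(7,8)[OF \<omega> k(1)] .
  have dmb: "d m b = l"
    unfolding b_def using geodesicD(7)[OF \<mu> l(1)] .
  have k_ge: "\<phi> m \<le> h + k"
    using \<phi>_lip[OF mx(1) ab(1)] dma k(2) unfolding a_def by simp
  have k_le: "k \<le> G"
  proof -
    \<comment> \<open>Since \<open>m\<close> is nearest to \<open>w\<close>, passing from
      \<open>a\<close> to \<open>b\<close> must make up for the \<open>k\<close> steps by which
      \<open>a\<close> is closer to \<open>w\<close> than \<open>m\<close>.\<close>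
    have "d w m \<le> d w b"
      unfolding b_def using l(1) by (rule nearest)
    also have "\<dots> \<le> d w a + d a b"
      using w ab by (intro dist_triangle)
    finally show ?thesis
      using dma k(1) dist_sym[OF w ab(1)] dist_sym[OF w mx(1)] unfolding G_def by linarith
  qed
  have l_le: "l \<le> k + G"
    using dist_triangle[OF mx(1) ab] dma dmb unfolding G_def by simp
  obtain i where i: "i \<le> d w x" "d a (\<alpha> i) = h"
    using \<phi>_ex[of a] k(2) unfolding a_def by auto
  obtain j where j: "j \<le> d w x" "d b (\<alpha> j) = h"
    using \<phi>_ex[of b] l(2) unfolding b_def by auto
  \<comment> \<open>\<open>f\<close> is \<open>h\<close> on the sides from \<open>m\<close> to
    \<open>a\<close> and \<open>b\<close> and 0 on \<open>\<alpha>\<close>, while \<open>g\<close>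
    rises from 0 at \<open>a\<close> to \<open>G\<close> at \<open>b\<close>.\<close>
  define f where "f y = int (min (\<phi> y) h)" for y
  define g where "g y = int (d a y)" for y
  have f: "lipschitz f"
    unfolding lipschitz_def
  proof (intro ballI impI)
    fix u v assume "u \<in> V" "v \<in> V" "d u v \<le> 1"
    then have "\<phi> u \<le> \<phi> v + 1" "\<phi> v \<le> \<phi> u + 1"
      using \<phi>_lip[of u v] \<phi>_lip[of v u] dist_sym[of u v] by auto
    then show "\<bar>f u - f v\<bar> \<le> 1"
      unfolding f_def by (auto simp: min_def)
  qed
  have g: "lipschitz g"
    unfolding lipschitz_def
  proof (intro ballI impI)
    fix u v assume "u \<in> V" "v \<in> V" "d u v \<le> 1"
    then have "d a u \<le> d a v + 1" "d a v \<le> d a u + 1"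
      using dist_triangle[of a u v] dist_triangle[of a v u] dist_sym[of u v] ab by auto
    then show "\<bar>g u - g v\<bar> \<le> 1"
      unfolding g_def by auto
  qed
  \<comment> \<open>The closed walk goes from \<open>a\<close> through \<open>m\<close> to
    \<open>b\<close>, down to \<open>\<alpha> j\<close>, along \<open>\<alpha>\<close> to
    \<open>\<alpha> i\<close> and up to \<open>a\<close>. Its two level sides contribute 2hG, the
    part on \<open>\<alpha>\<close> nothing, and each leg at most h^2 in absolute value.\<close>
  obtain W0 where W0: "walk m W0 a" "length W0 = k" "set (m # W0) = \<omega> ` {0..k}"
    using geodesic_subwalk[OF \<omega> le0 k(1)] unfolding a_def geodesicD(1)[OF \<omega>] diff_zero .
  obtain W1 where W1: "walk a W1 m" "length W1 = k" "set (a # W1) = \<omega> ` {0..k}"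
    using walk_reverse[OF W0(1)] W0(2,3) by metis
  obtain W2 where W2: "walk m W2 b" "length W2 = l" "set (m # W2) = \<mu> ` {0..l}"
    using geodesic_subwalk[OF \<mu> le0 l(1)] unfolding b_def geodesicD(1)[OF \<mu>] diff_zero .
  obtain W3 where W3: "walk b W3 (\<alpha> j)" "length W3 = h"
    using walk_exists[OF ab(2) \<alpha>V[OF j(1)], of h] j(2) by auto
  obtain W4 where W4: "walk (\<alpha> j) W4 (\<alpha> i)" "length W4 = d (\<alpha> j) (\<alpha> i)"
    "set (\<alpha> j # W4) \<subseteq> \<alpha> ` {..d w x}"
    using geodesic_connect[OF \<alpha> j(1) i(1)] .
  \<comment> \<open>The leg is built downwards and then reversed, because the square bound wants
    \<open>f\<close> to vanish at the end of the walk.\<close>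
  obtain W where W: "walk a W (\<alpha> i)" "length W = h"
    using walk_exists[OF ab(1) \<alpha>V[OF i(1)], of h] i(2) by auto
  obtain W5 where W5: "walk (\<alpha> i) W5 a" "length W5 = h"
    "stieltjes2 f g (\<alpha> i) W5 = - stieltjes2 f g a W"
    using walk_reverse[OF W(1)] W(2) by metis
  have "f y = int h" if "y \<in> set (a # W1)" for y
    using that k(3) unfolding W1(3) f_def by (auto simp: min_absorb2)
  then have "stieltjes2 f g a W1 = 2 * int h * (g m - g a)"
    unfolding walk_last[OF W1(1), symmetric] by (rule stieltjes2_const_left)
  moreover have "f y = int h" if "y \<in> set (m # W2)" for y
    using that l(3) unfolding W2(3) f_def by (auto simp: min_absorb2)
  then have "stieltjes2 f g m W2 = 2 * int h * (g b - g m)"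
    unfolding walk_last[OF W2(1), symmetric] by (rule stieltjes2_const_left)
  ultimately have 12: "stieltjes2 f g a W1 + stieltjes2 f g m W2 = 2 * int h * int G"
    using ab(1) dist_self by (simp add: g_def G_def algebra_simps)
  have f0: "f (\<alpha> i) = 0" if "i \<le> d w x" for i
    unfolding f_def using \<phi>0[OF that] by simp
  have 3: "\<bar>stieltjes2 f g b W3\<bar> \<le> (int h)\<^sup>2"
    using abs_stieltjes2_le_square[OF W3(1) f g f0[OF j(1)]] W3(2) by simp
  have 5: "\<bar>stieltjes2 f g (\<alpha> i) W5\<bar> \<le> (int h)\<^sup>2"
    using abs_stieltjes2_le_square[OF W(1) f g f0[OF i(1)]] W(2) W5(3) by simp
  have 4: "stieltjes2 f g (\<alpha> j) W4 = 0"
  proof -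
    have "f y = 0" if "y \<in> set (\<alpha> j # W4)" for y
      using that W4(3) f0 by blast
    then show ?thesis
      using stieltjes2_const_left[of "\<alpha> j" W4 f 0 g] by simp
  qed
  define C where "C = W1 @ W2 @ W3 @ W4 @ W5"
  have "walk a C a"
    unfolding C_def
    by (intro walk_appendI[OF W1(1)] walk_appendI[OF W2(1)] walk_appendI[OF W3(1)]
      walk_appendI[OF W4(1)] W5(1))
  then have "2 * \<bar>stieltjes2 f g a C\<bar> \<le> int M * int (length C)"
    using f g by (rule linear_isoperimetric)
  moreover have "stieltjes2 f g a C = 2 * int h * int G + stieltjes2 f g b W3 + stieltjes2 f g (\<alpha> i) W5"
    unfolding C_def stieltjes2_walk_append[OF W1(1)] stieltjes2_walk_append[OF W2(1)]
      stieltjes2_walk_append[OF W3(1)] stieltjes2_walk_append[OF W4(1)] 4 using 12 by simp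
  ultimately have lower: "4 * int h * int G - 4 * (int h)\<^sup>2 \<le> int M * int (length C)"
    using 3 5 by arith
  have "d (\<alpha> j) (\<alpha> i) \<le> G + 2 * h"
  proof -
    have "d (\<alpha> j) (\<alpha> i) \<le> d (\<alpha> j) b + d b (\<alpha> i)" "d b (\<alpha> i) \<le> d b a + d a (\<alpha> i)"
      using ab \<alpha>V[OF i(1)] \<alpha>V[OF j(1)] by (simp_all only: dist_triangle)
    moreover have "d (\<alpha> j) b = h" "d b a = G"
      using dist_sym[OF ab] dist_sym[OF ab(2) \<alpha>V[OF j(1)]] j(2) unfolding G_def by simp_all
    ultimately show ?thesis using i(2) by linarith
  qed
  \<comment> \<open>The five pieces have lengths at most G, 2G, h, G + 2h and h.\<close>
  then have "length C \<le> 4 * G + 4 * h"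
    unfolding C_def using W1(2) W2(2) W3(2) W4(2) W5(2) k_le l_le by simp
  then have "int M * int (length C) \<le> int M * (4 * int G + 4 * int h)"
    by (intro mult_left_mono) auto
  \<comment> \<open>Cancelling \<open>M\<close> leaves G \<le> 6M, whereas G \<ge> k > 8M -
    2M.\<close>
  with lower have "int M * (8 * int G - 16 * int M) \<le> int M * (4 * int G + 8 * int M)"
    unfolding h_def by (simp add: power2_eq_square algebra_simps)
  moreover have "0 < M"
    using s_le_M s'_less_s by linarith
  ultimately have "G \<le> 6 * M"
    by simp
  then show False
    using k_le k_ge \<phi>m unfolding h_def by linarith
qed

section \<open>The four-point condition\<close>

text \<open>Project \<open>u\<close> and \<open>v\<close> to a geodesic from \<open>x\<close> to
  \<open>y\<close>. If the projection of \<open>u\<close> comes first, the triangles towards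
  \<open>y\<close> and towards \<open>x\<close> lose 16M each, and the path from \<open>u\<close> to
  \<open>v\<close> through both projections gives the bound. Otherwise \<open>u\<close> and
  \<open>v\<close> are exchanged.\<close>

lemma four_point:
  assumes V: "u \<in> V" "v \<in> V" "x \<in> V" "y \<in> V"
  shows "d u v + d x y \<le> max (d u x + d v y) (d u y + d v x) + 32 * M"
proof -
  obtain \<gamma> where \<gamma>: "geodesic \<gamma> x y"
    using geodesic_exists V by blast
  let ?n = "d x y"
  have project: "\<exists>i\<le>?n. \<forall>k\<le>?n. d u (\<gamma> i) \<le> d u (\<gamma> k)" for u
    using ex_has_least_nat[of "\<lambda>i. i \<le> ?n" 0 "\<lambda>i. d u (\<gamma> i)"] by auto
  have \<gamma>V: "\<gamma> i \<in> V" if "i \<le> ?n" for i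
    using \<gamma> that by (simp add: geodesic_def)
  \<comment> \<open>The geodesic and its ends are generalised so that the reversed geodesic is
    covered too.\<close>
  have right: "d u (\<gamma> i) + (?n - i) \<le> d u y + 16 * M"
    if "u \<in> V" "geodesic \<gamma> x y" "d x y = ?n" "i \<le> ?n" "\<And>k. k \<le> ?n \<Longrightarrow> d u (\<gamma> i) \<le> d u (\<gamma> k)"
    for u i \<gamma> x y
    using right_triangle[OF that(1) geodesic_sub(1)[OF that(2), of i]]
      geodesic_sub(2)[OF that(2), of i] that(3-5) by simp
  have ordered: "d u v + ?n \<le> d u y + d v x + 32 * M"
    if uv: "u \<in> V" "v \<in> V" and ij: "i \<le> j" "j \<le> ?n"
      and i: "\<forall>k\<le>?n. d u (\<gamma> i) \<le> d u (\<gamma> k)" and j: "\<forall>k\<le>?n. d v (\<gamma> j) \<le> d v (\<gamma> k)"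
    for u v i j
  proof -
    have "d u (\<gamma> i) + (?n - i) \<le> d u y + 16 * M"
      using right[OF uv(1) \<gamma> refl] i ij by auto
    moreover have "d v (\<gamma> j) + j \<le> d v x + 16 * M"
      \<comment> \<open>The index \<open>?n - j\<close> on the reversed geodesic is the same point,
        with \<open>j\<close> steps left to \<open>x\<close>.\<close>
      using right[OF uv(2) geodesic_sym[OF \<gamma>] dist_sym[OF V(4,3)], of "?n - j"] j ij by auto
    moreover have ijV: "\<gamma> i \<in> V" "\<gamma> j \<in> V"
      using \<gamma>V ij by simp_all
    note dist_triangle[OF uv(1) ijV(1) uv(2)] dist_triangle[OF ijV uv(2)] dist_sym[OF ijV(2) uv(2)]
    moreover have "d (\<gamma> i) (\<gamma> j) = j - i"
      using \<gamma> ij by (simp add: geodesic_def)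
    ultimately show ?thesis
      using ij by linarith
  qed
  obtain i j where ij: "i \<le> ?n" "\<forall>k\<le>?n. d u (\<gamma> i) \<le> d u (\<gamma> k)"
    "j \<le> ?n" "\<forall>k\<le>?n. d v (\<gamma> j) \<le> d v (\<gamma> k)"
    using project[of u] project[of v] by blast
  show ?thesis
  proof (cases "i \<le> j")
    case True
    then show ?thesis using ordered[OF V(1,2) True] ij by auto
  next
    case False
    then have "d v u + ?n \<le> d v y + d u x + 32 * M"
      using ordered[OF V(2,1), of j i] ij by auto
    then show ?thesis using dist_sym[OF V(1,2)] by auto
  qed
qed

end

section \<open>Graph distance and dismantling orders\<close>

lemma graph_metric_gdist:
  assumes "pair_bidirected_digraph G" "Digraph_Component.connected (with_proj G)"
  shows "graph_metric (pverts G) (gdist G)"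
proof -
  interpret pair_bidirected_digraph G by fact
  have walk_ex: "\<exists>p. awalk u p v" if "u \<in> pverts G" "v \<in> pverts G" for u v
  proof -
    \<comment> \<open>Connectedness is strong connectedness of the symmetric closure; the arcs are
      symmetric already, so reachability is the same in \<open>G\<close>.\<close>
    have "u \<rightarrow>\<^sup>*\<^bsub>with_proj (mk_symmetric (with_proj G))\<^esub> v"
      using assms(2) that unfolding connected_def strongly_connected_def by simp
    then have "u \<rightarrow>\<^sup>*\<^bsub>with_proj G\<^esub> v"
      using reachable_mk_symmetric_eq[OF pair_sym_arcs] by simp
    then show ?thesis by (simp add: reachable_awalk)
  qed
  have le: "gdist G u v \<le> length p" if "awalk u p v" for u p v
    unfolding gdist_def using that by (intro Least_le) blast
  have ex: "\<exists>p. awalk u p v \<and> length p = gdist G u v" if "u \<in> pverts G" "v \<in> pverts G" for u v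
  proof -
    have "\<exists>n p. awalk u p v \<and> length p = n"
      using walk_ex[OF that] by blast
    then show ?thesis
      unfolding gdist_def by (rule LeastI_ex)
  qed
  have rev_ex: "\<exists>q. awalk v q u \<and> length q = length p" if "awalk u p v" for u p v
    using that
  proof (induction p arbitrary: u)
    case Nil
    then show ?case by (auto simp: awalk_Nil_iff)
  next
    case (Cons e p)
    then have e: "e \<in> parcs G" "u = fst e" "awalk (snd e) p v"
      by (auto simp: awalk_Cons_iff)
    then obtain q where q: "awalk v q (snd e)" "length q = length p"
      using Cons.IH by blast
    have "(snd e, fst e) \<in> parcs G"
      using e(1) arcs_symmetric by (cases e) auto
    then have "awalk (snd e) [(snd e, fst e)] u"
      using e in_arcsD1 in_arcsD2 by (auto simp: awalk_Cons_iff awalk_Nil_iff)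
    then have "awalk v (q @ [(snd e, fst e)]) u"
      using q(1) awalk_appendI by blast
    then show ?case using q(2) by (intro exI[of _ "q @ [(snd e, fst e)]"]) simp
  qed
  have sym_le: "gdist G v u \<le> gdist G u v" if "u \<in> pverts G" "v \<in> pverts G" for u v
    using ex[OF that] rev_ex le by metis
  show ?thesis
  proof
    show "gdist G x x = 0" if "x \<in> pverts G" for x
      using le[of x "[]" x] that by (simp add: awalk_Nil_iff)
    show "x = y" if "x \<in> pverts G" "y \<in> pverts G" "gdist G x y = 0" for x y
      using ex[OF that(1,2)] that(3) by (auto simp: awalk_Nil_iff)
    show "gdist G x y = gdist G y x" if "x \<in> pverts G" "y \<in> pverts G" for x y
      using sym_le that by (simp add: antisym)
    show "gdist G x z \<le> gdist G x y + gdist G y z"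
      if xyz: "x \<in> pverts G" "y \<in> pverts G" "z \<in> pverts G" for x y z
    proof -
      obtain p q where "awalk x p y" "length p = gdist G x y" "awalk y q z" "length q = gdist G y z"
        using ex[OF xyz(1,2)] ex[OF xyz(2,3)] by blast
      then show ?thesis using le[of x "p @ q" z] awalk_appendI by fastforce
    qed
    show "\<exists>z\<in>pverts G. gdist G x z \<le> 1 \<and> gdist G z y = n"
      if xy: "x \<in> pverts G" "y \<in> pverts G" and n: "gdist G x y = Suc n" for x y n
    proof -
      \<comment> \<open>The second vertex of a shortest walk is the required intermediate
        point.\<close>
      obtain p where "awalk x p y" "length p = Suc n"
        using ex[OF xy] n by auto
      then obtain e q where "awalk x (e # q) y" and q: "length q = n"
        by (cases p) auto
      then have e: "e \<in> parcs G" "x = fst e" "awalk (snd e) q y"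
        by (auto simp: awalk_Cons_iff)
      have z: "snd e \<in> pverts G" using e(1) by (rule arc_snd_in_verts)
      have e1: "awalk x [e] (snd e)"
        using e z by (simp add: awalk_Cons_iff awalk_Nil_iff)
      obtain r where r: "awalk (snd e) r y" "length r = gdist G (snd e) y"
        using ex[OF z xy(2)] by blast
      have "gdist G x y \<le> 1 + gdist G (snd e) y"
        using le[OF awalk_appendI[OF e1 r(1)]] r(2) by simp
      then have "gdist G (snd e) y = n"
        using n le[OF e(3)] q by simp
      then show ?thesis using z le[OF e1] by auto
    qed
  qed
qed

text \<open>An infinite \<open>V\<close> may lack a greatest vertex, but a walk visits only finitely
  many vertices.\<close>

lemma finite_has_greatest:
  assumes "well_order_on V R" "finite S" "S \<noteq> {}" "S \<subseteq> V"
  shows "\<exists>v\<in>S. \<forall>w\<in>S. (w, v) \<in> R"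
  using assms(2-4)
proof (induction rule: finite_ne_induct)
  case (singleton x)
  then show ?case
    using assms(1) by (auto simp: order_on_defs refl_on_def)
next
  case (insert x F)
  then obtain v where v: "v \<in> F" "\<forall>w\<in>F. (w, v) \<in> R" by auto
  have "x \<in> V" "v \<in> V" "x \<noteq> v"
    using insert.prems insert.hyps v(1) by auto
  then have "(x, v) \<in> R \<or> (v, x) \<in> R" "(x, x) \<in> R" "trans R"
    using assms(1) by (auto simp: order_on_defs refl_on_def total_on_def)
  then show ?case
  proof (elim disjE)
    assume "(x, v) \<in> R"
    then show ?thesis using v by (intro bexI[of _ v]) auto
  next
    assume "(v, x) \<in> R"
    then have "\<forall>w\<in>F. (w, x) \<in> R"
      using v(2) \<open>trans R\<close> by (blast dest: transD)
    then show ?thesis using \<open>(x, x) \<in> R\<close> by (intro bexI[of _ x]) auto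
  qed
qed

text \<open>For the greatest vertex \<open>v\<close> of \<open>S\<close>, all of \<open>S\<close>
  lies in \<open>under R v\<close>, so the inclusion of balls applies to every vertex of
  \<open>S\<close>.\<close>

lemma star_dismantlable_shortcut:
  assumes "graph_metric (pverts G) (gdist G)" "star_dismantlable s s' G"
    and S: "finite S" "S \<noteq> {}" "S \<subseteq> pverts G"
  shows "\<exists>v\<in>S. \<exists>u\<in>pverts G. \<forall>w\<in>S. gdist G v w \<le> s \<longrightarrow> gdist G u w \<le> s'"
proof -
  interpret graph_metric "pverts G" "gdist G" by fact
  obtain R where R: "well_order_on (pverts G) R"
    and dis: "\<And>v. v \<in> pverts G \<Longrightarrow> \<not> (\<forall>w \<in> pverts G. (v, w) \<in> R) \<Longrightarrow>
        \<exists>u \<in> pverts G. u \<noteq> v \<and> (u, v) \<in> R \<and> gball G s v \<inter> under R v \<subseteq> gball G s' u"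
    using assms(2) unfolding star_dismantlable_def by metis
  obtain v where v: "v \<in> S" "\<forall>w\<in>S. (w, v) \<in> R"
    using finite_has_greatest[OF R S] by blast
  show ?thesis
  proof (cases "\<forall>w \<in> pverts G. (v, w) \<in> R")
    case True
    have "antisym R" using R by (auto simp: order_on_defs)
    then have "S = {v}" using True v S by (auto dest: antisymD)
    then show ?thesis using S dist_self by (intro bexI[of _ v]) auto
  next
    case False
    then obtain u where "u \<in> pverts G" "gball G s v \<inter> under R v \<subseteq> gball G s' u"
      using dis v S by blast
    then show ?thesis
      using v S unfolding gball_def under_def by blast
  qed
qed

section \<open>The hyperbolicity constant\<close>

text \<open>The symmetric hypotheses avoid deciding which of the three sums is largest.\<close>

lemma sort_three_gap:
  fixes a b c K :: nat
  assumes "a \<le> max b c + K" "b \<le> max a c + K" "c \<le> max a b + K"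
  shows "sort [a, b, c] ! 2 \<le> sort [a, b, c] ! 1 + K"
  using assms by (auto simp: numeral_2_eq_2)

theorem theorem3:
  fixes G :: "'a pair_pre_digraph" and s s' :: nat
  assumes "pair_bidirected_digraph G"
    and "Digraph_Component.connected (with_proj G)"
    and "0 < s'" and "s' < s"
    and "star_dismantlable s s' G"
  shows "hyperbolic
           (16 * (real s + real s') * real_of_int \<lceil>(real s + real s') / (real s - real s')\<rceil> + 1 / 2) G
         \<and> 16 * (real s + real s') * real_of_int \<lceil>(real s + real s') / (real s - real s')\<rceil> + 1 / 2
           \<le> 32 * (real s * (real s + real s') / (real s - real s')) + 1 / 2"
proof
  let ?q = "(real s + real s') / (real s - real s')"
  define M where "M = (s + s') * nat \<lceil>?q\<rceil>"
  have pos: "0 < real s - real s'" "0 \<le> ?q"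
    using assms(4) by auto
  have ceil: "real (nat \<lceil>?q\<rceil>) = real_of_int \<lceil>?q\<rceil>" "?q \<le> real_of_int \<lceil>?q\<rceil>"
    "real_of_int \<lceil>?q\<rceil> \<le> ?q + 1"
    using pos(2) by (auto simp: of_nat_nat of_int_ceiling_le_add_one)
  have M: "real M = (real s + real s') * real_of_int \<lceil>?q\<rceil>"
    unfolding M_def using ceil(1) by simp
  \<comment> \<open>Multiplying this by s + s' gives \<open>M_bound\<close>; the ceiling makes
    \<open>M\<close> a natural number.\<close>
  have "real s + real s' \<le> real_of_int \<lceil>?q\<rceil> * (real s - real s')"
    using ceil(2) unfolding pos_divide_le_eq[OF pos(1)] .
  then have "(real s + real s') * (real s + real s')
      \<le> (real s + real s') * (real_of_int \<lceil>?q\<rceil> * (real s - real s'))"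
    by (intro mult_left_mono) auto
  then have "real ((s + s')\<^sup>2) \<le> real (M * (s - s'))"
    using assms(4) by (simp add: M of_nat_diff power2_eq_square mult.assoc)
  then have M_bound: "(s + s')\<^sup>2 \<le> M * (s - s')"
    by (simp only: of_nat_le_iff)
  have gm: "graph_metric (pverts G) (gdist G)"
    using assms(1,2) by (rule graph_metric_gdist)
  interpret shortcut_metric "pverts G" "gdist G" s s' M
    using gm assms(4) M_bound star_dismantlable_shortcut[OF gm assms(5)]
    by (intro shortcut_metric.intro shortcut_metric_axioms.intro)
  let ?\<delta> = "16 * (real s + real s') * real_of_int \<lceil>?q\<rceil> + 1 / 2"
  have \<delta>: "?\<delta> = 16 * real M + 1 / 2"
    by (simp only: M mult.assoc)
  have real_gap: "real a - real b \<le> 2 * (16 * real M + 1 / 2)" if "a \<le> b + 32 * M" for a b :: nat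
    using that by simp
  show "hyperbolic ?\<delta> G"
    unfolding hyperbolic_def Let_def \<delta>
  proof (intro conjI ballI)
    fix u v x y
    assume V: "u \<in> pverts G" "v \<in> pverts G" "x \<in> pverts G" "y \<in> pverts G"
    let ?S = "sort [gdist G u v + gdist G x y, gdist G u x + gdist G v y, gdist G u y + gdist G v x]"
    \<comment> \<open>Permuting the four points lets each of the three sums be the one bounded by
      the other two.\<close>
    have "?S ! 2 \<le> ?S ! 1 + 32 * M"
      using four_point[OF V] four_point[OF V(1,3,2,4)] four_point[OF V(1,4,2,3)]
        dist_sym[OF V(3,2)] dist_sym[OF V(4,3)] dist_sym[OF V(4,2)]
      by (intro sort_three_gap) (simp_all add: max.commute add.commute)
    then show "real (?S ! 2) - real (?S ! 1) \<le> 2 * (16 * real M + 1 / 2)"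
      by (rule real_gap)
  qed simp
  \<comment> \<open>Rounding up costs at most 1, and adding 1 to \<open>?q\<close> turns its
    numerator s + s' into 2s.\<close>
  have "real M \<le> (real s + real s') * (?q + 1)"
    unfolding M using ceil(3) by (intro mult_left_mono) auto
  also have "?q + 1 = 2 * real s / (real s - real s')"
    using pos(1) by (simp add: field_simps)
  also have "(real s + real s') * (2 * real s / (real s - real s'))
      = 2 * (real s * (real s + real s') / (real s - real s'))"
    by simp
  finally show "?\<delta> \<le> 32 * (real s * (real s + real s') / (real s - real s')) + 1 / 2"
    unfolding \<delta> by linarith
qed

end
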